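(* There is a function $g(d)=O(\log^2 d\,\log\log d)$ such that for every integer $n$ and all $d=d(n)$, $d'=d'(n)$ with $d\le n/2$ and $g(d)<d'\le d-1$: (i) $\mathsf{NOBDD^{\lfloor\log d\rfloor}}\subsetneq\mathsf{OBDD^{d}}$; and (ii) $\mathsf{OBDD^{d}}$ and $\mathsf{NOBDD^{d'}}$ are incomparable, i.e. neither is contained in the other.
   Context: $\log$ is base $2$. $\mathsf{OBDD^d}$ (resp. $\mathsf{NOBDD^d}$) denotes the set of Boolean functions $f:\{0,1\}^n\to\{0,1\}$ computable by a deterministic (resp. nondeterministic) OBDD of width $d$ (at most $d$ nodes per level), $n$ being the number of variables. A deterministic OBDD on $x_1,\dots,x_n$ with order $\pi$ (a permutation of $\{1,\dots,n\}$) is a leveled directed acyclic graph with levels $0,\dots,n$, a single source at level $0$, every node at level $j-1$ having exactly one outgoing edge labelled $0$ and one labelled $1$ to nodes at level $j$, and nodes at level $n$ marked accepting or rejecting; on input $\nu$ one follows from the source at step $j$ the edge labelled $\nu_{\pi(j)}$ and outputs $1$ iff an accepting node is reached. A nondeterministic OBDD allows any number of outgoing edges with each label and outputs $1$ iff some consistent path reaches an accepting node. Width is the maximum number of nodes in a level. *)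

theory Defs
  imports
    Complex_Main
    "HOL-Library.FuncSet"
    "HOL-Library.Disjoint_Sets"
    "HOL-Library.Landau_Symbols"
    "HOL-Combinatorics.Permutations"
begin

text \<open>
  Inputs and Boolean functions in \<open>n\<close> variables are extensional functions, so that
  equality and inclusion of classes only depend on the values on \<open>{0,1}\<^sup>n\<close>.
\<close>

definition cube :: "nat \<Rightarrow> (nat \<Rightarrow> bool) set" where
  "cube n = {1..n} \<rightarrow>\<^sub>E UNIV"

definition boolean_functions :: "nat \<Rightarrow> ((nat \<Rightarrow> bool) \<Rightarrow> bool) set" where
  "boolean_functions n = cube n \<rightarrow>\<^sub>E UNIV"

text \<open>
  A triple \<open>(u, b, v)\<close> in \<open>edges P\<close> is an edge from \<open>u\<close> to \<open>v\<close> labelled \<open>b\<close>.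
  Parallel edges with the same label are identified; they do not affect the computed function.
  Only the levels \<open>0, \<dots>, n\<close> are meaningful.
\<close>

record 'v bdd =
  var_order :: "nat \<Rightarrow> nat"
  level :: "nat \<Rightarrow> 'v set"
  edges :: "('v \<times> bool \<times> 'v) set"
  accepting :: "'v set"

definition nobdd :: "nat \<Rightarrow> 'v bdd \<Rightarrow> bool" where
  "nobdd n P \<longleftrightarrow>
     var_order P permutes {1..n} \<and>
     (\<forall>j\<in>{0..n}. finite (level P j)) \<and>
     disjoint_family_on (level P) {0..n} \<and>
     (\<exists>s. level P 0 = {s}) \<and>
     edges P \<subseteq> (\<Union>j\<in>{1..n}. level P (j - 1) \<times> UNIV \<times> level P j) \<and>
     accepting P \<subseteq> level P n"

definition obdd :: "nat \<Rightarrow> 'v bdd \<Rightarrow> bool" where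
  "obdd n P \<longleftrightarrow>
     nobdd n P \<and>
     (\<forall>j\<in>{1..n}. \<forall>u\<in>level P (j - 1). \<forall>b. \<exists>!v. (u, b, v) \<in> edges P)"

definition consistent_path :: "nat \<Rightarrow> 'v bdd \<Rightarrow> (nat \<Rightarrow> bool) \<Rightarrow> (nat \<Rightarrow> 'v) \<Rightarrow> bool" where
  "consistent_path n P \<nu> p \<longleftrightarrow>
     p 0 \<in> level P 0 \<and>
     (\<forall>j\<in>{1..n}. (p (j - 1), \<nu> (var_order P j), p j) \<in> edges P)"

text \<open>
  For a deterministic diagram there is exactly one consistent path (see
  \<open>obdd_unique_path\<close> below), so this also describes deterministic acceptance.
\<close>

definition accepts :: "nat \<Rightarrow> 'v bdd \<Rightarrow> (nat \<Rightarrow> bool) \<Rightarrow> bool" where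
  "accepts n P \<nu> \<longleftrightarrow> (\<exists>p. consistent_path n P \<nu> p \<and> p n \<in> accepting P)"

definition computes :: "nat \<Rightarrow> 'v bdd \<Rightarrow> ((nat \<Rightarrow> bool) \<Rightarrow> bool) \<Rightarrow> bool" where
  "computes n P f \<longleftrightarrow> (\<forall>\<nu>\<in>cube n. f \<nu> \<longleftrightarrow> accepts n P \<nu>)"

definition width :: "nat \<Rightarrow> 'v bdd \<Rightarrow> nat" where
  "width n P = Max ((\<lambda>j. card (level P j)) ` {0..n})"

text \<open>Diagrams are finite, so taking natural numbers as nodes is no restriction.\<close>

definition OBDD :: "nat \<Rightarrow> nat \<Rightarrow> ((nat \<Rightarrow> bool) \<Rightarrow> bool) set" where
  "OBDD n d =
     {f \<in> boolean_functions n. \<exists>P :: nat bdd. obdd n P \<and> width n P \<le> d \<and> computes n P f}"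

definition NOBDD :: "nat \<Rightarrow> nat \<Rightarrow> ((nat \<Rightarrow> bool) \<Rightarrow> bool) set" where
  "NOBDD n d =
     {f \<in> boolean_functions n. \<exists>P :: nat bdd. nobdd n P \<and> width n P \<le> d \<and> computes n P f}"

lemma obdd_unique_path:
  assumes P: "obdd n P"
  shows "\<exists>p. consistent_path n P \<nu> p \<and>
           (\<forall>q. consistent_path n P \<nu> q \<longrightarrow> (\<forall>j\<le>n. q j = p j))"
proof -
  have N: "nobdd n P" using P by (simp add: obdd_def)
  then obtain s where s: "level P 0 = {s}" unfolding nobdd_def by blast
  define p where "p = rec_nat s (\<lambda>i u. THE v. (u, \<nu> (var_order P (Suc i)), v) \<in> edges P)"
  have p0: "p 0 = s" by (simp add: p_def)
  have pS: "p (Suc i) = (THE v. (p i, \<nu> (var_order P (Suc i)), v) \<in> edges P)" for i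
    by (simp add: p_def)
  have ex1: "\<exists>!v. (u, b, v) \<in> edges P" if "u \<in> level P i" "i < n" for u b i
  proof -
    have "Suc i \<in> {1..n}" "u \<in> level P (Suc i - 1)" using that by auto
    then show ?thesis using P unfolding obdd_def by blast
  qed
  have next_level: "v \<in> level P (Suc i)"
    if e: "(u, b, v) \<in> edges P" and u: "u \<in> level P i" and i: "i < n" for u b v i
  proof -
    obtain m where m: "m \<in> {1..n}" "u \<in> level P (m - 1)" "v \<in> level P m"
      using N e unfolding nobdd_def by blast
    have "level P (m - 1) \<inter> level P i = {}" if "m - 1 \<noteq> i"
    proof -
      have "m - 1 \<in> {0..n}" "i \<in> {0..n}" using m(1) i by auto
      then show ?thesis using N that unfolding nobdd_def disjoint_family_on_def by blast
    qed
    then have "m - 1 = i" using m u by blast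
    then have "m = Suc i" using m(1) by auto
    then show ?thesis using m by simp
  qed
  have lev: "i \<le> n \<Longrightarrow> p i \<in> level P i" for i
  proof (induction i)
    case 0
    then show ?case by (simp add: p0 s)
  next
    case (Suc i)
    then have "p i \<in> level P i" "i < n" by auto
    then show ?case using theI'[OF ex1] next_level unfolding pS by blast
  qed
  have step: "(p i, \<nu> (var_order P (Suc i)), p (Suc i)) \<in> edges P" if "i < n" for i
    using theI'[OF ex1[OF lev that]] that unfolding pS by simp
  have cp: "consistent_path n P \<nu> p"
    unfolding consistent_path_def
  proof (intro conjI ballI)
    show "p 0 \<in> level P 0" by (simp add: p0 s)
  next
    fix j assume "j \<in> {1..n}"
    then show "(p (j - 1), \<nu> (var_order P j), p j) \<in> edges P"
      using step[of "j - 1"] by auto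
  qed
  have "q j = p j" if q: "consistent_path n P \<nu> q" and "j \<le> n" for q j
    using \<open>j \<le> n\<close>
  proof (induction j)
    case 0
    then show ?case using q s p0 by (simp add: consistent_path_def)
  next
    case (Suc i)
    then have i: "q i = p i" "i < n" "Suc i \<in> {1..n}" by auto
    then have "(q (Suc i - 1), \<nu> (var_order P (Suc i)), q (Suc i)) \<in> edges P"
      using q unfolding consistent_path_def by blast
    then show ?case using ex1[OF lev, of i] step[of i] i by auto
  qed
  then show ?thesis using cp by blast
qed

end

theory Submission
  imports Defs
begin

text \<open>
  The subset construction gives \<open>NOBDD\<^sup>w \<subseteq> OBDD\<close> of width \<open>2\<^sup>w\<close>. Testing whether \<open>d\<close> divides the
  number of ones needs \<open>d\<close> states even nondeterministically: after \<open>d\<close> variables, two prefixes with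
  distinct numbers of ones below \<open>d\<close> cannot share a node.

  For the other direction, ask whether some row or column of a \<open>k \<times> k\<close> matrix is zero. Guessing the
  line takes width \<open>2k\<close>. A deterministic diagram, whatever its order, rejects all \<open>k!\<close> permutation
  matrices; cut each of these computations right after its \<open>m\<close>-th one has been read. Two of them
  meeting at the same node can be spliced, and the spliced matrix has to hit every line, which
  forces both prefixes to occupy the same \<open>m\<close> rows and the same \<open>m\<close> columns. So a node is shared by at most
  \<open>m!(k - m)!\<close> permutations. As a cut follows one of the \<open>k\<^sup>2\<close> matrix variables, the
  width is at least \<open>binomial k m / k\<^sup>2\<close>, independently of \<open>n\<close>, and \<open>k = O(log d)\<close> suffices to exceed \<open>d\<close>.
\<close>

section \<open>Leveled diagrams\<close>

lemma width_le_iff: "width n P \<le> d \<longleftrightarrow> (\<forall>j\<le>n. card (level P j) \<le> d)"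
  unfolding width_def by (subst Max_le_iff) auto

lemma nobdd_edgeD:
  assumes "nobdd n P" "(u, b, v) \<in> edges P"
  obtains j where "j < n" "u \<in> level P j" "v \<in> level P (Suc j)"
proof -
  obtain j where "j \<in> {1..n}" "u \<in> level P (j - 1)" "v \<in> level P j"
    using assms unfolding nobdd_def by blast
  then show ?thesis using that[of "j - 1"] by auto
qed

text \<open>Levels are pairwise disjoint, so a node determines its level. For \<open>i = n\<close>
  the claim is vacuous, since every edge starts below level \<open>n\<close>.\<close>

lemma nobdd_edge_level:
  assumes "nobdd n P" "(u, b, v) \<in> edges P" "u \<in> level P i" "i \<le> n"
  shows "v \<in> level P (Suc i)"
proof -
  obtain j where j: "j < n" "u \<in> level P j" "v \<in> level P (Suc j)"
    using nobdd_edgeD[OF assms(1,2)] by blast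
  have "j = i"
  proof (rule ccontr)
    assume "j \<noteq> i"
    then have "level P j \<inter> level P i = {}"
      using assms(1,4) j(1) unfolding nobdd_def disjoint_family_on_def by simp
    then show False using j(2) assms(3) by blast
  qed
  then show ?thesis using j by simp
qed

lemma consistent_path_step:
  "consistent_path n P \<nu> p \<Longrightarrow> i < n \<Longrightarrow> (p i, \<nu> (var_order P (Suc i)), p (Suc i)) \<in> edges P"
  unfolding consistent_path_def by (drule conjunct2, drule bspec[of _ _ "Suc i"]) auto

lemma consistent_pathI:
  assumes "p 0 \<in> level P 0"
    and "\<And>i. i < n \<Longrightarrow> (p i, \<nu> (var_order P (Suc i)), p (Suc i)) \<in> edges P"
  shows "consistent_path n P \<nu> p"
  unfolding consistent_path_def
proof (intro conjI ballI)
  fix j assume "j \<in> {1..n}"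
  then show "(p (j - 1), \<nu> (var_order P j), p j) \<in> edges P"
    using assms(2)[of "j - 1"] by auto
qed (rule assms(1))

lemma consistent_path_level:
  assumes "nobdd n P" "consistent_path n P \<nu> p" "i \<le> n"
  shows "p i \<in> level P i"
  using assms(3)
proof (induction i)
  case 0
  then show ?case using assms(2) by (simp add: consistent_path_def)
next
  case (Suc i)
  then show ?case
    using nobdd_edge_level[OF assms(1) consistent_path_step[OF assms(2), of i]] by simp
qed

lemma obdd_path_eq:
  assumes "obdd n P" "consistent_path n P \<nu> p" "consistent_path n P \<nu> q" "j \<le> n"
  shows "p j = q j"
  using obdd_unique_path[OF assms(1), of \<nu>] assms(2-4) by metis

section \<open>Renaming nodes along an injection\<close>

definition map_nodes :: "('v \<Rightarrow> 'w) \<Rightarrow> 'v bdd \<Rightarrow> 'w bdd" where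
  "map_nodes h P =
     \<lparr>var_order = var_order P,
      level = (\<lambda>j. h ` level P j),
      edges = (\<lambda>(u, b, v). (h u, b, h v)) ` edges P,
      accepting = h ` accepting P\<rparr>"

lemma map_nodes_sel [simp]:
  "var_order (map_nodes h P) = var_order P"
  "level (map_nodes h P) j = h ` level P j"
  "accepting (map_nodes h P) = h ` accepting P"
  by (simp_all add: map_nodes_def)

lemma map_nodes_edge_iff:
  "(u', b, v') \<in> edges (map_nodes h P) \<longleftrightarrow> (\<exists>u v. u' = h u \<and> v' = h v \<and> (u, b, v) \<in> edges P)"
  by (force simp: map_nodes_def)

context
  fixes n :: nat and P :: "'v bdd" and h :: "'v \<Rightarrow> 'w"
  assumes N: "nobdd n P" and h: "inj_on h (\<Union>j\<le>n. level P j)"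
begin

lemma nobdd_map_nodes: "nobdd n (map_nodes h P)"
  unfolding nobdd_def
proof (intro conjI)
  show "var_order (map_nodes h P) permutes {1..n}" using N by (simp add: nobdd_def)
  show "\<forall>j\<in>{0..n}. finite (level (map_nodes h P) j)" using N by (simp add: nobdd_def)
  show "\<exists>s. level (map_nodes h P) 0 = {s}" using N by (auto simp: nobdd_def)
  show "accepting (map_nodes h P) \<subseteq> level (map_nodes h P) n"
    using N by (auto simp: nobdd_def)
  show "disjoint_family_on (level (map_nodes h P)) {0..n}"
    unfolding disjoint_family_on_def
  proof (intro ballI impI)
    fix i j assume ij: "i \<in> {0..n}" "j \<in> {0..n}" "i \<noteq> j"
    then have "level P i \<inter> level P j = {}"
      using N unfolding nobdd_def disjoint_family_on_def by blast
    moreover have "h ` (level P i \<inter> level P j) = h ` level P i \<inter> h ` level P j"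
      using ij by (intro inj_on_image_Int[OF h]) auto
    ultimately show "level (map_nodes h P) i \<inter> level (map_nodes h P) j = {}" by simp
  qed
  show "edges (map_nodes h P)
      \<subseteq> (\<Union>j\<in>{1..n}. level (map_nodes h P) (j - 1) \<times> UNIV \<times> level (map_nodes h P) j)"
  proof (clarify)
    fix u' b v' assume "(u', b, v') \<in> edges (map_nodes h P)"
    then obtain u v where uv: "u' = h u" "v' = h v" "(u, b, v) \<in> edges P"
      by (auto simp: map_nodes_edge_iff)
    then obtain j where "j < n" "u \<in> level P j" "v \<in> level P (Suc j)"
      using nobdd_edgeD[OF N] by metis
    then show "(u', b, v')
        \<in> (\<Union>j\<in>{1..n}. level (map_nodes h P) (j - 1) \<times> UNIV \<times> level (map_nodes h P) j)"
      using uv by (intro UN_I[of "Suc j"]) auto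
  qed
qed

text \<open>The renaming is injective only on levels \<open>0\<close> to \<open>n\<close>. The
  source of every edge lies there, so \<open>h u\<close> still identifies \<open>u\<close>.\<close>

lemma map_nodes_edge_source:
  assumes "(h u, b, v') \<in> edges (map_nodes h P)" "u \<in> level P j" "j \<le> n"
  shows "\<exists>v. v' = h v \<and> (u, b, v) \<in> edges P"
proof -
  obtain w v where w: "h u = h w" "v' = h v" "(w, b, v) \<in> edges P"
    using assms(1) by (auto simp: map_nodes_edge_iff)
  obtain i where "i < n" "w \<in> level P i"
    using nobdd_edgeD[OF N w(3)] by blast
  then have "u = w" using w(1) assms(2,3) by (intro inj_onD[OF h]) auto
  then show ?thesis using w by blast
qed

lemma obdd_map_nodes:
  assumes "obdd n P" shows "obdd n (map_nodes h P)"
  unfolding obdd_def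
proof (intro conjI ballI allI)
  show "nobdd n (map_nodes h P)" by (rule nobdd_map_nodes)
  fix j u' b assume j: "j \<in> {1..n}" and "u' \<in> level (map_nodes h P) (j - 1)"
  then obtain u where u: "u' = h u" "u \<in> level P (j - 1)" by auto
  obtain v where v: "(u, b, v) \<in> edges P" "\<And>w. (u, b, w) \<in> edges P \<Longrightarrow> w = v"
    using assms j u(2) unfolding obdd_def by blast
  show "\<exists>!v'. (u', b, v') \<in> edges (map_nodes h P)"
  proof
    show "(u', b, h v) \<in> edges (map_nodes h P)" using u(1) v(1) by (auto simp: map_nodes_edge_iff)
    fix v' assume "(u', b, v') \<in> edges (map_nodes h P)"
    then obtain w where "v' = h w" "(u, b, w) \<in> edges P"
      using map_nodes_edge_source[of u b v' "j - 1"] u j by fastforce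
    then show "v' = h v" using v(2)[of w] by simp
  qed
qed

lemma accepts_map_nodes: "accepts n (map_nodes h P) \<nu> \<longleftrightarrow> accepts n P \<nu>"
proof
  assume "accepts n P \<nu>"
  then obtain p where p: "consistent_path n P \<nu> p" "p n \<in> accepting P"
    unfolding accepts_def by blast
  have "consistent_path n (map_nodes h P) \<nu> (h \<circ> p)"
    using consistent_path_level[OF N p(1), of 0] consistent_path_step[OF p(1)]
    by (intro consistent_pathI) (auto simp: map_nodes_edge_iff)
  then show "accepts n (map_nodes h P) \<nu>" using p(2) unfolding accepts_def by auto
next
  let ?g = "inv_into (\<Union>j\<le>n. level P j) h"
  assume "accepts n (map_nodes h P) \<nu>"
  then obtain q where q: "consistent_path n (map_nodes h P) \<nu> q" "q n \<in> h ` accepting P"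
    unfolding accepts_def by auto
  \<comment> \<open>A renamed path is pulled back node by node; each \<open>q i\<close> is the image
    of a node of level \<open>i\<close>, and \<open>?g\<close> returns exactly that node.\<close>
  have lev: "?g (q i) \<in> level P i \<and> h (?g (q i)) = q i" if i: "i \<le> n" for i
  proof -
    obtain u where u: "u \<in> level P i" "q i = h u"
      using consistent_path_level[OF nobdd_map_nodes q(1) i] by auto
    have "?g (q i) = u" using u i by (auto intro!: inv_into_f_f[OF h])
    then show ?thesis using u by simp
  qed
  have "consistent_path n P \<nu> (?g \<circ> q)"
  proof (rule consistent_pathI)
    show "(?g \<circ> q) 0 \<in> level P 0" using lev[of 0] by simp
    fix i assume i: "i < n"
    have "(h (?g (q i)), \<nu> (var_order P (Suc i)), q (Suc i)) \<in> edges (map_nodes h P)"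
      using consistent_path_step[OF q(1) i] lev[of i] i by simp
    then obtain v where v: "q (Suc i) = h v" "(?g (q i), \<nu> (var_order P (Suc i)), v) \<in> edges P"
      using map_nodes_edge_source[of "?g (q i)" "\<nu> (var_order P (Suc i))" "q (Suc i)" i] lev[of i] i
      by auto
    have "v \<in> level P (Suc i)" using nobdd_edge_level[OF N v(2)] lev[of i] i by simp
    then have "?g (q (Suc i)) = v" using v(1) i by (auto intro!: inv_into_f_f[OF h] intro: UN_I[of "Suc i"])
    then show "((?g \<circ> q) i, \<nu> (var_order P (Suc i)), (?g \<circ> q) (Suc i)) \<in> edges P"
      using v(2) by simp
  qed
  moreover have "(?g \<circ> q) n \<in> accepting P"
  proof -
    obtain u where u: "u \<in> accepting P" "q n = h u" using q(2) by auto
    then have "u \<in> level P n" using N by (auto simp: nobdd_def)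
    then have "?g (q n) = u" using u(2) by (auto intro!: inv_into_f_f[OF h])
    then show ?thesis using u by simp
  qed
  ultimately show "accepts n P \<nu>" unfolding accepts_def by blast
qed

lemma width_map_nodes_le:
  assumes "width n P \<le> d" shows "width n (map_nodes h P) \<le> d"
  unfolding width_le_iff
proof (intro allI impI)
  fix j assume j: "j \<le> n"
  then have "finite (level P j)" using N by (simp add: nobdd_def)
  then have "card (h ` level P j) \<le> card (level P j)" by (rule card_image_le)
  also have "\<dots> \<le> d" using assms j by (simp add: width_le_iff)
  finally show "card (level (map_nodes h P) j) \<le> d" by simp
qed

end

lemma ex_inj_on_nodes:
  assumes "nobdd n P" shows "\<exists>h :: 'v \<Rightarrow> nat. inj_on h (\<Union>j\<le>n. level (P :: 'v bdd) j)"
proof -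
  have "finite (\<Union>j\<le>n. level P j)" using assms by (simp add: nobdd_def)
  then show ?thesis using finite_imp_inj_to_nat_seg by blast
qed

text \<open>The classes ask for diagrams with natural numbers as nodes. As the levels are finite,
  the nodes inject into \<open>nat\<close>, so constructions may use any node type.\<close>

lemma NOBDD_I:
  assumes "nobdd n P" "width n P \<le> d" "computes n P f" "f \<in> boolean_functions n"
  shows "f \<in> NOBDD n d"
proof -
  obtain h :: "_ \<Rightarrow> nat" where h: "inj_on h (\<Union>j\<le>n. level P j)"
    using ex_inj_on_nodes[OF assms(1)] by blast
  have "computes n (map_nodes h P) f"
    using assms(3) by (simp add: computes_def accepts_map_nodes[OF assms(1) h])
  then show ?thesis
    using nobdd_map_nodes[OF assms(1) h] width_map_nodes_le[OF assms(1) h assms(2)] assms(4)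
    unfolding NOBDD_def by blast
qed

lemma OBDD_I:
  assumes "obdd n P" "width n P \<le> d" "computes n P f" "f \<in> boolean_functions n"
  shows "f \<in> OBDD n d"
proof -
  have N: "nobdd n P" using assms(1) by (simp add: obdd_def)
  obtain h :: "_ \<Rightarrow> nat" where h: "inj_on h (\<Union>j\<le>n. level P j)"
    using ex_inj_on_nodes[OF N] by blast
  have "computes n (map_nodes h P) f"
    using assms(3) by (simp add: computes_def accepts_map_nodes[OF N h])
  then show ?thesis
    using obdd_map_nodes[OF N h assms(1)] width_map_nodes_le[OF N h assms(2)] assms(4)
    unfolding OBDD_def by blast
qed

section \<open>Diagrams built from state sets and transitions\<close>

definition layered ::
    "nat \<Rightarrow> (nat \<Rightarrow> nat) \<Rightarrow> (nat \<Rightarrow> 'a set) \<Rightarrow> (nat \<Rightarrow> 'a \<Rightarrow> bool \<Rightarrow> 'a \<Rightarrow> bool) \<Rightarrow> 'a set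
      \<Rightarrow> (nat \<times> 'a) bdd" where
  "layered n \<pi> S T A =
     \<lparr>var_order = \<pi>,
      level = (\<lambda>j. {j} \<times> S j),
      edges = {((j, u), b, (Suc j, v)) | j u b v. j < n \<and> u \<in> S j \<and> v \<in> S (Suc j) \<and> T (Suc j) u b v},
      accepting = {n} \<times> A\<rparr>"

lemma layered_sel [simp]:
  "var_order (layered n \<pi> S T A) = \<pi>"
  "level (layered n \<pi> S T A) j = {j} \<times> S j"
  "accepting (layered n \<pi> S T A) = {n} \<times> A"
  "((i, u), b, (j, v)) \<in> edges (layered n \<pi> S T A)
     \<longleftrightarrow> j = Suc i \<and> i < n \<and> u \<in> S i \<and> v \<in> S (Suc i) \<and> T (Suc i) u b v"
  by (auto simp: layered_def)

text \<open>Tagging each state with its level makes the levels disjoint, so the sets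
  \<open>S j\<close> may overlap or coincide.\<close>

lemma nobdd_layered:
  assumes "\<pi> permutes {1..n}" "\<And>j. j \<le> n \<Longrightarrow> finite (S j)" "S 0 = {s}" "A \<subseteq> S n"
  shows "nobdd n (layered n \<pi> S T A)"
  unfolding nobdd_def
proof (intro conjI)
  show "edges (layered n \<pi> S T A) \<subseteq> (\<Union>j\<in>{1..n}.
      level (layered n \<pi> S T A) (j - 1) \<times> UNIV \<times> level (layered n \<pi> S T A) j)"
  proof (clarify)
    fix i u b j v assume "((i, u), b, (j, v)) \<in> edges (layered n \<pi> S T A)"
    then show "((i, u), b, (j, v)) \<in> (\<Union>j\<in>{1..n}.
        level (layered n \<pi> S T A) (j - 1) \<times> UNIV \<times> level (layered n \<pi> S T A) j)"
      by (intro UN_I[of "Suc i"]) auto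
  qed
qed (use assms in \<open>auto simp: disjoint_family_on_def\<close>)

lemma accepts_layered_iff:
  "accepts n (layered n \<pi> S T A) \<nu> \<longleftrightarrow>
     (\<exists>q. q 0 \<in> S 0 \<and> q n \<in> A \<and>
        (\<forall>i<n. q i \<in> S i \<and> q (Suc i) \<in> S (Suc i) \<and> T (Suc i) (q i) (\<nu> (\<pi> (Suc i))) (q (Suc i))))"
    (is "?L \<longleftrightarrow> (\<exists>q. ?R q)")
proof
  assume ?L
  then obtain p where p: "consistent_path n (layered n \<pi> S T A) \<nu> p" "p n \<in> {n} \<times> A"
    unfolding accepts_def by auto
  have "?R (snd \<circ> p)"
  proof (intro conjI allI impI)
    show "(snd \<circ> p) 0 \<in> S 0" using p(1) by (auto simp: consistent_path_def)
    show "(snd \<circ> p) n \<in> A" using p(2) by auto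
    fix i assume "i < n"
    from consistent_path_step[OF p(1) this]
    have e: "((fst (p i), snd (p i)), \<nu> (\<pi> (Suc i)), (fst (p (Suc i)), snd (p (Suc i))))
        \<in> edges (layered n \<pi> S T A)" by simp
    \<comment> \<open>The tags along a path are forced, so a path carries no more information than
      its sequence of states.\<close>
    have "fst (p i) = i" using \<open>i < n\<close>
    proof (induction i)
      case 0
      then show ?case using p(1) by (auto simp: consistent_path_def)
    next
      case (Suc i)
      from consistent_path_step[OF p(1), of i] Suc.prems
      have "((fst (p i), snd (p i)), \<nu> (\<pi> (Suc i)), (fst (p (Suc i)), snd (p (Suc i))))
        \<in> edges (layered n \<pi> S T A)" by simp
      then show ?case using Suc unfolding layered_sel by simp
    qed
    with e show "(snd \<circ> p) i \<in> S i" "(snd \<circ> p) (Suc i) \<in> S (Suc i)"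
      "T (Suc i) ((snd \<circ> p) i) (\<nu> (\<pi> (Suc i))) ((snd \<circ> p) (Suc i))"
      unfolding layered_sel by simp_all
  qed
  then show "\<exists>q. ?R q" by blast
next
  assume "\<exists>q. ?R q"
  then obtain q where q: "?R q" by blast
  then have "consistent_path n (layered n \<pi> S T A) \<nu> (\<lambda>i. (i, q i))"
    by (intro consistent_pathI) auto
  then show ?L using q unfolding accepts_def by auto
qed

lemma NOBDD_layered:
  assumes "\<pi> permutes {1..n}" "\<And>j. j \<le> n \<Longrightarrow> finite (S j)" "S 0 = {s}" "A \<subseteq> S n"
    and "\<And>j. j \<le> n \<Longrightarrow> card (S j) \<le> d" "f \<in> boolean_functions n"
    and "\<And>\<nu>. \<nu> \<in> cube n \<Longrightarrow> f \<nu> \<longleftrightarrow> (\<exists>q. q 0 \<in> S 0 \<and> q n \<in> A \<and>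
        (\<forall>i<n. q i \<in> S i \<and> q (Suc i) \<in> S (Suc i) \<and> T (Suc i) (q i) (\<nu> (\<pi> (Suc i))) (q (Suc i))))"
  shows "f \<in> NOBDD n d"
proof (rule NOBDD_I)
  show "nobdd n (layered n \<pi> S T A)" using assms(1-4) by (rule nobdd_layered)
  show "width n (layered n \<pi> S T A) \<le> d" using assms(5) by (simp add: width_le_iff card_cartesian_product_singleton)
  show "computes n (layered n \<pi> S T A) f"
    using assms(7) by (simp add: computes_def accepts_layered_iff)
qed (rule assms(6))

text \<open>The run \<open>q \<nu>\<close> is supplied by the user, possibly in closed form. The
  recursion \<open>q0\<close>, \<open>qS\<close> determines it, and \<open>closed\<close> keeps it
  inside the levels, so it is the only path on \<open>\<nu>\<close>.\<close>

lemma OBDD_layered: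
  assumes "\<pi> permutes {1..n}" "\<And>j. j \<le> n \<Longrightarrow> finite (S j)" "S 0 = {s}" "A \<subseteq> S n"
    and "\<And>j. j \<le> n \<Longrightarrow> card (S j) \<le> d" "f \<in> boolean_functions n"
    and closed: "\<And>j u b. j < n \<Longrightarrow> u \<in> S j \<Longrightarrow> \<delta> (Suc j) u b \<in> S (Suc j)"
    and q0: "\<And>\<nu>. q \<nu> 0 = s" and qS: "\<And>\<nu> j. q \<nu> (Suc j) = \<delta> (Suc j) (q \<nu> j) (\<nu> (\<pi> (Suc j)))"
    and acc: "\<And>\<nu>. \<nu> \<in> cube n \<Longrightarrow> f \<nu> \<longleftrightarrow> q \<nu> n \<in> A"
  shows "f \<in> OBDD n d"
proof (rule OBDD_I)
  let ?P = "layered n \<pi> S (\<lambda>j u b v. v = \<delta> j u b) A"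
  have N: "nobdd n ?P" using assms(1-4) by (rule nobdd_layered)
  show "obdd n ?P"
    unfolding obdd_def
  proof (intro conjI N ballI allI)
    fix j x b assume "j \<in> {1..n}" "x \<in> level ?P (j - 1)"
    then obtain i u where i: "j = Suc i" "i < n" "x = (i, u)" "u \<in> S i"
      by (cases j) auto
    show "\<exists>!y. (x, b, y) \<in> edges ?P"
    proof
      show "(x, b, (j, \<delta> j u b)) \<in> edges ?P" using i closed by simp
      show "y = (j, \<delta> j u b)" if "(x, b, y) \<in> edges ?P" for y
        using that i by (cases y) simp
    qed
  qed
  show "width n ?P \<le> d" using assms(5) by (simp add: width_le_iff card_cartesian_product_singleton)
  have "accepts n ?P \<nu> \<longleftrightarrow> q \<nu> n \<in> A" for \<nu>
  proof -
    have *: "q \<nu> i \<in> S i" if "i \<le> n" for i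
      using that by (induction i) (auto simp: q0 qS assms(3) closed)
    show ?thesis
      unfolding accepts_layered_iff
    proof
      assume "q \<nu> n \<in> A"
      then show "\<exists>q. q 0 \<in> S 0 \<and> q n \<in> A \<and> (\<forall>i<n. q i \<in> S i \<and> q (Suc i) \<in> S (Suc i)
          \<and> q (Suc i) = \<delta> (Suc i) (q i) (\<nu> (\<pi> (Suc i))))"
        using * by (intro exI[of _ "q \<nu>"]) (auto simp: qS[symmetric])
    next
      assume "\<exists>q. q 0 \<in> S 0 \<and> q n \<in> A \<and> (\<forall>i<n. q i \<in> S i \<and> q (Suc i) \<in> S (Suc i)
          \<and> q (Suc i) = \<delta> (Suc i) (q i) (\<nu> (\<pi> (Suc i))))"
      then obtain r where r: "r 0 = s" "r n \<in> A"
        "\<And>i. i < n \<Longrightarrow> r (Suc i) = \<delta> (Suc i) (r i) (\<nu> (\<pi> (Suc i)))"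
        using assms(3) by auto
      have "r i = q \<nu> i" if "i \<le> n" for i
        using that by (induction i) (auto simp: q0 qS r)
      then show "q \<nu> n \<in> A" using r(2) by simp
    qed
  qed
  then show "computes n ?P f" using acc by (simp add: computes_def)
qed (rule assms(6))

lemma NOBDD_mono: "d \<le> d' \<Longrightarrow> NOBDD n d \<subseteq> NOBDD n d'"
  unfolding NOBDD_def by fastforce

lemma OBDD_mono: "d \<le> d' \<Longrightarrow> OBDD n d \<subseteq> OBDD n d'"
  unfolding OBDD_def by fastforce

section \<open>Determinisation\<close>

text \<open>The state after \<open>j\<close> steps is the set of nodes that some consistent path of
  length \<open>j\<close> reaches; a level of at most \<open>w\<close> nodes has at most
  \<open>2 ^ w\<close> subsets.\<close>

theorem NOBDD_subset_OBDD_exp: "NOBDD n w \<subseteq> OBDD n (2 ^ w)"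
proof
  fix f assume "f \<in> NOBDD n w"
  then obtain P :: "nat bdd" where P: "nobdd n P" "width n P \<le> w" "computes n P f"
    and f: "f \<in> boolean_functions n"
    unfolding NOBDD_def by blast
  define \<delta> where "\<delta> = (\<lambda>j::nat. \<lambda>X b. {v. \<exists>u\<in>X. (u, b, v) \<in> edges P})"
  define q where "q = (\<lambda>\<nu>. rec_nat (level P 0) (\<lambda>i X. \<delta> (Suc i) X (\<nu> (var_order P (Suc i)))))"
  \<comment> \<open>Level 0 of the new diagram must consist of a single node, so the full power set
    is used only from level 1 on.\<close>
  define S where "S j = (if j = 0 then {level P 0} else Pow (level P j))" for j
  have fin: "finite (level P j)" if "j \<le> n" for j using P(1) that by (simp add: nobdd_def)
  have reach: "v \<in> q \<nu> j \<longleftrightarrow> (\<exists>p. consistent_path j P \<nu> p \<and> p j = v)" for \<nu> j v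
  proof (induction j arbitrary: v)
    case 0
    show ?case
    proof
      assume "v \<in> q \<nu> 0"
      then show "\<exists>p. consistent_path 0 P \<nu> p \<and> p 0 = v"
        by (intro exI[of _ "\<lambda>_. v"]) (simp add: q_def consistent_path_def)
    qed (auto simp: q_def consistent_path_def)
  next
    case (Suc j)
    have S: "v \<in> q \<nu> (Suc j) \<longleftrightarrow> (\<exists>u\<in>q \<nu> j. (u, \<nu> (var_order P (Suc j)), v) \<in> edges P)"
      by (simp add: q_def \<delta>_def)
    show ?case
    proof
      assume "v \<in> q \<nu> (Suc j)"
      then obtain p where p: "consistent_path j P \<nu> p"
        and e: "(p j, \<nu> (var_order P (Suc j)), v) \<in> edges P"
        unfolding S Bex_def Suc.IH by blast
      \<comment> \<open>A path of length \<open>j\<close> is redefined at \<open>Suc j\<close>; its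
        values up to \<open>j\<close>, and hence the earlier edges, are unchanged.\<close>
      have "consistent_path (Suc j) P \<nu> (p(Suc j := v))"
        using p e consistent_path_step[OF p]
        by (intro consistent_pathI) (auto simp: consistent_path_def less_Suc_eq)
      then show "\<exists>p. consistent_path (Suc j) P \<nu> p \<and> p (Suc j) = v" by fastforce
    next
      assume "\<exists>p. consistent_path (Suc j) P \<nu> p \<and> p (Suc j) = v"
      then obtain p where p: "consistent_path (Suc j) P \<nu> p" "p (Suc j) = v" by blast
      then have "consistent_path j P \<nu> p" by (simp add: consistent_path_def)
      then show "v \<in> q \<nu> (Suc j)"
        unfolding S Bex_def Suc.IH using consistent_path_step[OF p(1), of j] p(2) by auto
    qed
  qed
  have "f \<in> OBDD n (2 ^ w)"
  proof (rule OBDD_layered)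
    show "var_order P permutes {1..n}" using P(1) by (simp add: nobdd_def)
    show "finite (S j)" if "j \<le> n" for j using fin[OF that] by (simp add: S_def)
    show "S 0 = {level P 0}" by (simp add: S_def)
    show "{X \<in> S n. X \<inter> accepting P \<noteq> {}} \<subseteq> S n" by blast
    show "card (S j) \<le> 2 ^ w" if "j \<le> n" for j
    proof -
      have "card (level P j) \<le> w" using P(2) that by (simp add: width_le_iff)
      then show ?thesis using fin[OF that] by (simp add: S_def card_Pow)
    qed
    show "f \<in> boolean_functions n" by (rule f)
    show "\<delta> (Suc j) X b \<in> S (Suc j)" if "j < n" "X \<in> S j" for j X b
    proof -
      have "X \<subseteq> level P j" using that(2) by (auto simp: S_def split: if_splits)
      then show ?thesis
        using nobdd_edge_level[OF P(1)] that(1) by (fastforce simp: S_def \<delta>_def)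
    qed
    show "q \<nu> 0 = level P 0" "q \<nu> (Suc j) = \<delta> (Suc j) (q \<nu> j) (\<nu> (var_order P (Suc j)))" for \<nu> j
      by (simp_all add: q_def)
    fix \<nu> assume "\<nu> \<in> cube n"
    then have "f \<nu> \<longleftrightarrow> q \<nu> n \<inter> accepting P \<noteq> {}"
      using P(3) unfolding computes_def accepts_def by (force simp: reach)
    moreover have "q \<nu> n \<in> S n"
    proof (cases "n = 0")
      case True
      then show ?thesis by (simp add: S_def q_def)
    next
      case False
      have "q \<nu> n \<subseteq> level P n"
        using consistent_path_level[OF P(1), of \<nu> _ n] by (auto simp: reach)
      then show ?thesis using False by (simp add: S_def)
    qed
    ultimately show "f \<nu> \<longleftrightarrow> q \<nu> n \<in> {X \<in> S n. X \<inter> accepting P \<noteq> {}}" by blast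
  qed
  then show "f \<in> OBDD n (2 ^ w)" .
qed

section \<open>Splicing two computations at a common node\<close>

definition splice :: "'v bdd \<Rightarrow> nat \<Rightarrow> (nat \<Rightarrow> bool) \<Rightarrow> (nat \<Rightarrow> bool) \<Rightarrow> nat \<Rightarrow> bool" where
  "splice P t \<nu> \<mu> i = (if i \<in> var_order P ` {1..t} then \<nu> i else \<mu> i)"

lemma splice_in_cube: "\<nu> \<in> cube n \<Longrightarrow> \<mu> \<in> cube n \<Longrightarrow> splice P t \<nu> \<mu> \<in> cube n"
  by (auto simp: cube_def splice_def PiE_def extensional_def)

lemma splice_var_order:
  assumes "nobdd n P"
  shows "splice P t \<nu> \<mu> (var_order P j) =
    (if j \<in> {1..t} then \<nu> (var_order P j) else \<mu> (var_order P j))"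
proof -
  have "inj (var_order P)" using assms by (auto simp: nobdd_def dest: permutes_inj)
  then show ?thesis by (simp add: splice_def inj_image_mem_iff)
qed

text \<open>Each variable is read only once, so the spliced input agrees at every step with the
  input whose path is being followed. The common node at step \<open>t\<close> joins the two
  halves.\<close>

lemma consistent_path_splice:
  assumes "nobdd n P" "consistent_path n P \<nu> p" "consistent_path n P \<mu> q" "p t = q t"
  shows "consistent_path n P (splice P t \<nu> \<mu>) (\<lambda>j. if j \<le> t then p j else q j)"
proof (rule consistent_pathI)
  show "(if 0 \<le> t then p 0 else q 0) \<in> level P 0"
    using assms(2) by (simp add: consistent_path_def)
  fix i assume i: "i < n"
  show "(if i \<le> t then p i else q i, splice P t \<nu> \<mu> (var_order P (Suc i)),
      if Suc i \<le> t then p (Suc i) else q (Suc i)) \<in> edges P"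
    using consistent_path_step[OF assms(2) i] consistent_path_step[OF assms(3) i] assms(4)
    unfolding splice_var_order[OF assms(1)] by (cases "i = t") auto
qed

section \<open>Counting ones modulo d\<close>

definition ones_dvd :: "nat \<Rightarrow> nat \<Rightarrow> (nat \<Rightarrow> bool) \<Rightarrow> bool" where
  "ones_dvd n d = restrict (\<lambda>\<nu>. d dvd card {i \<in> {1..n}. \<nu> i}) (cube n)"

lemma ones_dvd_boolean: "ones_dvd n d \<in> boolean_functions n"
  by (simp add: ones_dvd_def boolean_functions_def)

lemma ones_dvd_in_OBDD:
  assumes "d > 0" shows "ones_dvd n d \<in> OBDD n d"
proof (rule OBDD_layered)
  \<comment> \<open>The state is the number of ones read so far modulo \<open>d\<close>; level 0 is
    cut down to the single node 0.\<close>
  let ?S = "\<lambda>j::nat. if j = 0 then {0} else {..<d}"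
  let ?\<delta> = "\<lambda>j::nat. \<lambda>u b. if b then Suc u mod d else u"
  let ?q = "\<lambda>(\<nu> :: nat \<Rightarrow> bool) j. card {i \<in> {1..j}. \<nu> i} mod d"
  show "id permutes {1..n}" by (rule permutes_id)
  show "finite (?S j)" "card (?S j) \<le> d" for j using assms by auto
  show "?S 0 = {0}" by simp
  show "{0} \<subseteq> ?S n" using assms by auto
  show "ones_dvd n d \<in> boolean_functions n" by (rule ones_dvd_boolean)
  show "?\<delta> (Suc j) u b \<in> ?S (Suc j)" if "u \<in> ?S j" for j u b
    using that assms by (auto split: if_splits)
  show "?q \<nu> 0 = 0" for \<nu>
  proof -
    have "{i \<in> {1..0}. \<nu> i} = {}" by auto
    then show ?thesis by (simp only: card.empty mod_0)
  qed
  show "?q \<nu> (Suc j) = ?\<delta> (Suc j) (?q \<nu> j) (\<nu> (id (Suc j)))" for \<nu> j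
  proof -
    have "{i \<in> {1..Suc j}. \<nu> i} =
        (if \<nu> (Suc j) then insert (Suc j) {i \<in> {1..j}. \<nu> i} else {i \<in> {1..j}. \<nu> i})"
      by (auto simp: le_Suc_eq)
    then show ?thesis by (simp add: mod_Suc_eq)
  qed
  show "ones_dvd n d \<nu> \<longleftrightarrow> ?q \<nu> n \<in> {0}" if "\<nu> \<in> cube n" for \<nu>
    using that by (simp add: ones_dvd_def dvd_eq_mod_eq_0)
qed

lemma ones_dvd_not_in_NOBDD:
  assumes "w < d" "2 * d \<le> n" shows "ones_dvd n d \<notin> NOBDD n w"
proof
  assume "ones_dvd n d \<in> NOBDD n w"
  then obtain P :: "nat bdd" where P: "nobdd n P" "width n P \<le> w" "computes n P (ones_dvd n d)"
    unfolding NOBDD_def by blast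
  let ?\<pi> = "var_order P"
  have perm: "?\<pi> permutes {1..n}" using P(1) by (simp add: nobdd_def)
  \<comment> \<open>Counting ones in reading order gives the same number, because the variable order
    is a permutation.\<close>
  have accepts_iff: "accepts n P \<nu> \<longleftrightarrow> d dvd card {j \<in> {1..n}. \<nu> (?\<pi> j)}" if "\<nu> \<in> cube n" for \<nu>
  proof -
    have "{i \<in> ?\<pi> ` {1..n}. \<nu> i} = ?\<pi> ` {j \<in> {1..n}. \<nu> (?\<pi> j)}" by auto
    then have "card {i \<in> {1..n}. \<nu> i} = card {j \<in> {1..n}. \<nu> (?\<pi> j)}"
      using permutes_inj_on[OF perm] by (simp only: permutes_image[OF perm] card_image)
    moreover have "ones_dvd n d \<nu> \<longleftrightarrow> accepts n P \<nu>"
      using P(3) that unfolding computes_def by blast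
    ultimately show ?thesis using that by (simp add: ones_dvd_def)
  qed
  \<comment> \<open>In reading order, \<open>x c\<close> has \<open>c\<close> ones among the first
    \<open>d\<close> positions and \<open>d - c\<close> ones right after position \<open>d\<close>,
    hence \<open>d\<close> in total. The bound \<open>2 * d \<le> n\<close> leaves room for
    them.\<close>
  define x where "x c = restrict (\<lambda>i. inv ?\<pi> i \<in> {1..c} \<union> {d<..2 * d - c}) {1..n}" for c
  have x_cube: "x c \<in> cube n" for c by (simp add: x_def cube_def)
  have x_\<pi>: "x c (?\<pi> j) \<longleftrightarrow> j \<in> {1..c} \<union> {d<..2 * d - c}" if "j \<in> {1..n}" for c j
  proof -
    have "?\<pi> j \<in> {1..n}" using that permutes_in_image[OF perm] by blast
    then show ?thesis by (simp add: x_def permutes_inverses[OF perm])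
  qed
  have "\<exists>p. consistent_path n P (x c) p \<and> p n \<in> accepting P" if "c < d" for c
  proof -
    have "{j \<in> {1..n}. x c (?\<pi> j)} = {1..c} \<union> {d<..2 * d - c}"
      using x_\<pi> that assms(2) by auto
    also have "card \<dots> = d" using that by (subst card_Un_disjoint) auto
    finally have "accepts n P (x c)" by (simp add: accepts_iff[OF x_cube])
    then show ?thesis unfolding accepts_def by blast
  qed
  then obtain p where p: "\<And>c. c < d \<Longrightarrow> consistent_path n P (x c) (p c)"
    and acc_p: "\<And>c. c < d \<Longrightarrow> p c n \<in> accepting P" by metis
  have "(\<lambda>c. p c d) ` {..<d} \<subseteq> level P d"
    using consistent_path_level[OF P(1) p, of _ d] assms(2) by auto
  moreover have "finite (level P d)" "card (level P d) < d"
    using P(1,2) assms le_less_trans[of "card (level P d)" w d]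
    by (auto simp: nobdd_def width_le_iff)
  \<comment> \<open>Pigeonhole: \<open>d\<close> accepting paths cross level \<open>d\<close>, which
    has fewer than \<open>d\<close> nodes.\<close>
  ultimately have "\<not> inj_on (\<lambda>c. p c d) {..<d}"
    using card_inj_on_le[of "\<lambda>c. p c d" "{..<d}" "level P d"] by auto
  then obtain a c where ac: "a < c" "c < d" "p a d = p c d"
    by (auto simp: inj_on_def) (metis nat_neq_iff)
  let ?y = "splice P d (x a) (x c)"
  have "consistent_path n P ?y (\<lambda>j. if j \<le> d then p a j else p c j)"
    using ac by (intro consistent_path_splice[OF P(1)] p) auto
  then have acc: "accepts n P ?y"
    unfolding accepts_def using acc_p[OF ac(2)] ac assms(2)
    by (intro exI[of _ "\<lambda>j. if j \<le> d then p a j else p c j"]) auto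
  \<comment> \<open>The spliced input is accepted although its number of ones,
    \<open>a + (d - c)\<close>, lies strictly between 0 and \<open>d\<close>.\<close>
  have "{j \<in> {1..n}. ?y (?\<pi> j)} = {1..a} \<union> {d<..2 * d - c}"
    using x_\<pi> ac assms(2) by (auto simp: splice_var_order[OF P(1)])
  also have "card \<dots> = a + (d - c)" using ac by (subst card_Un_disjoint) auto
  finally have "d dvd a + (d - c)"
    using acc by (simp add: accepts_iff[OF splice_in_cube[OF x_cube x_cube]])
  then show False using ac by (auto dest: dvd_imp_le)
qed

section \<open>A matrix with a zero line\<close>

text \<open>Row-major numbering, with rows and columns counted from 0 and variables from 1. The
  matrix occupies the variables \<open>1\<close> to \<open>k * k\<close>.\<close>

definition cell :: "nat \<Rightarrow> nat \<Rightarrow> nat \<Rightarrow> nat" where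
  "cell k a b = Suc (a * k + b)"

lemma cell_eq_iff:
  assumes "b < k" "b' < k"
  shows "cell k a b = cell k a' b' \<longleftrightarrow> a = a' \<and> b = b'"
proof
  assume "cell k a b = cell k a' b'"
  then have e: "b + a * k = b' + a' * k" by (simp add: cell_def)
  have "(b + a * k) div k = a" "(b' + a' * k) div k = a'" using assms by auto
  with e show "a = a' \<and> b = b'" by auto
qed simp

lemma cell_bounds:
  assumes "a < k" "b < k" shows "cell k a b \<in> {1..k * k}"
proof -
  have "a * k + b < Suc a * k" using assms(2) by simp
  also have "\<dots> \<le> k * k" using assms(1) by (intro mult_le_mono1) simp
  finally show ?thesis by (simp add: cell_def)
qed

text \<open>Lines \<open>(True, a)\<close> are rows, lines \<open>(False, b)\<close> are columns.\<close>

definition line_cells :: "nat \<Rightarrow> bool \<times> nat \<Rightarrow> nat set" where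
  "line_cells k l = (if fst l then cell k (snd l) ` {..<k} else (\<lambda>a. cell k a (snd l)) ` {..<k})"

definition zero_line :: "nat \<Rightarrow> nat \<Rightarrow> (nat \<Rightarrow> bool) \<Rightarrow> bool" where
  "zero_line n k = restrict (\<lambda>\<nu>. \<exists>l\<in>UNIV \<times> {..<k}. \<forall>i\<in>line_cells k l. \<not> \<nu> i) (cube n)"

lemma zero_line_boolean: "zero_line n k \<in> boolean_functions n"
  by (simp add: zero_line_def boolean_functions_def)

lemma line_cells_subset: "l \<in> UNIV \<times> {..<k} \<Longrightarrow> line_cells k l \<subseteq> {1..k * k}"
  using cell_bounds by (auto simp: line_cells_def split: if_splits)

lemma not_zero_line_iff:
  assumes "\<nu> \<in> cube n"
  shows "\<not> zero_line n k \<nu> \<longleftrightarrow>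
    (\<forall>a<k. \<exists>b<k. \<nu> (cell k a b)) \<and> (\<forall>b<k. \<exists>a<k. \<nu> (cell k a b))"
proof -
  have "zero_line n k \<nu> \<longleftrightarrow>
      (\<exists>a<k. \<forall>i\<in>line_cells k (True, a). \<not> \<nu> i) \<or> (\<exists>b<k. \<forall>i\<in>line_cells k (False, b). \<not> \<nu> i)"
    using assms unfolding zero_line_def by (auto simp: Bex_def ex_bool_eq)
  then show ?thesis by (auto simp: line_cells_def)
qed

lemma zero_line_in_NOBDD:
  assumes "k > 0" "k * k \<le> n" shows "zero_line n k \<in> NOBDD n (2 * k)"
proof (rule NOBDD_layered)
  let ?L = "(UNIV :: bool set) \<times> {..<k}"
  \<comment> \<open>The state \<open>(True, 0)\<close> at level 0 is a placeholder. The line is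
    guessed on the step into level 1 and kept afterwards; as \<open>?T\<close> tests the target
    state, the first variable is already checked against the guess.\<close>
  let ?S = "\<lambda>j::nat. if j = 0 then {(True, 0::nat)} else ?L"
  let ?T = "\<lambda>j u b v. (j = Suc 0 \<or> u = v) \<and> (b \<longrightarrow> j \<notin> line_cells k v)"
  show "id permutes {1..n}" by (rule permutes_id)
  show "finite (?S j)" "card (?S j) \<le> 2 * k" for j
    using assms(1) by (auto simp: card_cartesian_product)
  show "?S 0 = {(True, 0)}" by simp
  show "?L \<subseteq> ?S n" using assms by auto
  show "zero_line n k \<in> boolean_functions n" by (rule zero_line_boolean)
  fix \<nu> assume \<nu>: "\<nu> \<in> cube n"
  show "zero_line n k \<nu> \<longleftrightarrow> (\<exists>q. q 0 \<in> ?S 0 \<and> q n \<in> ?L \<and>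
      (\<forall>i<n. q i \<in> ?S i \<and> q (Suc i) \<in> ?S (Suc i) \<and> ?T (Suc i) (q i) (\<nu> (id (Suc i))) (q (Suc i))))"
    (is "_ \<longleftrightarrow> (\<exists>q. ?R q)")
  proof
    assume "zero_line n k \<nu>"
    then obtain l where l: "l \<in> ?L" "\<forall>i\<in>line_cells k l. \<not> \<nu> i"
      using \<nu> unfolding zero_line_def by auto
    define q where "q = (\<lambda>i::nat. if i = 0 then (True, 0) else l)"
    have "?R q" using l assms by (auto simp: q_def)
    then show "\<exists>q. ?R q" by (rule exI[where x = q])
  next
    assume "\<exists>q. ?R q"
    then obtain q where q: "?R q" ..
    then have qn: "q n \<in> ?L"
      and stay: "\<And>i. 0 < i \<Longrightarrow> i < n \<Longrightarrow> q (Suc i) = q i"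
      and zero: "\<And>i. i < n \<Longrightarrow> \<nu> (Suc i) \<Longrightarrow> Suc i \<notin> line_cells k (q (Suc i))"
      by (simp, metis Suc_inject neq0_conv, simp)
    have const: "q (Suc i) = q n" if "i < n" for i
    proof -
      have "q (Suc (i + m)) = q (Suc i)" if "Suc (i + m) \<le> n" for m
        using that by (induction m) (auto simp: stay)
      from this[of "n - Suc i"] show ?thesis using that by simp
    qed
    have "\<not> \<nu> i" if i: "i \<in> line_cells k (q n)" for i
    proof -
      have "i \<in> {1..n}" using i line_cells_subset[OF qn] assms(2) by auto
      then obtain i' where i': "i = Suc i'" "i' < n" by (cases i) auto
      then show ?thesis using zero[of i'] const[of i'] i by auto
    qed
    then have "\<exists>l\<in>?L. \<forall>i\<in>line_cells k l. \<not> \<nu> i" by (intro bexI[OF _ qn]) blast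
    then show "zero_line n k \<nu>" using \<nu> by (simp add: zero_line_def)
  qed
qed

section \<open>Deterministic lower bound for the zero-line function, with its counting
  lemmas\<close>

lemma ex_rank:
  fixes h :: "'a \<Rightarrow> nat"
  assumes "finite A" "inj_on h A" "1 \<le> m" "m \<le> card A"
  shows "\<exists>a\<in>A. card {b \<in> A. h b \<le> h a} = m"
proof -
  let ?r = "\<lambda>a. card {b \<in> A. h b \<le> h a}"
  \<comment> \<open>The rank \<open>?r\<close> increases strictly with \<open>h\<close>, so it is
    injective on \<open>A\<close>; with values in \<open>{1..card A}\<close> it must be
    onto.\<close>
  have less: "?r a < ?r b" if "a \<in> A" "b \<in> A" "h a < h b" for a b
  proof (rule psubset_card_mono)
    have "b \<notin> {c \<in> A. h c \<le> h a}" "b \<in> {c \<in> A. h c \<le> h b}" using that by auto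
    moreover have "{c \<in> A. h c \<le> h a} \<subseteq> {c \<in> A. h c \<le> h b}" using that(3) by auto
    ultimately show "{c \<in> A. h c \<le> h a} \<subset> {c \<in> A. h c \<le> h b}" by blast
  qed (use assms(1) in auto)
  have "inj_on ?r A"
  proof (rule inj_onI)
    fix a b assume "a \<in> A" "b \<in> A" "?r a = ?r b"
    then show "a = b"
      using less[of a b] less[of b a] inj_onD[OF assms(2)] by (metis less_irrefl nat_neq_iff)
  qed
  moreover have "?r ` A \<subseteq> {1..card A}"
  proof (intro image_subsetI)
    fix a assume a: "a \<in> A"
    then have "{b \<in> A. h b \<le> h a} \<noteq> {}" by blast
    then have "0 < ?r a" using assms(1) by (simp add: card_gt_0_iff)
    moreover have "?r a \<le> card A" using assms(1) by (intro card_mono) auto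
    ultimately show "?r a \<in> {1..card A}" by simp
  qed
  ultimately have "?r ` A = {1..card A}"
    by (intro card_subset_eq) (auto simp: card_image)
  then show ?thesis using assms(3,4) by (metis (lifting) atLeastAtMost_iff imageE)
qed

lemma card_inj_on_PiE:
  assumes "finite A" "finite B" "card A = card B"
  shows "card {f \<in> A \<rightarrow>\<^sub>E B. inj_on f A} = fact (card A)"
  using card_inj_on_subset_funcset[OF assms(1,2) order_refl] assms(3)
  by (simp add: fact_prod_rev)

text \<open>Such a permutation is determined by its restrictions to \<open>R\<close> and to
  \<open>S - R\<close>, which are injections into \<open>C\<close> and \<open>S - C\<close>.\<close>

lemma card_permutes_image_le:
  assumes "finite S" "R \<subseteq> S" "C \<subseteq> S" "card C = card R"
  shows "card {\<sigma>. \<sigma> permutes S \<and> \<sigma> ` R = C} \<le> fact (card R) * fact (card S - card R)"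
proof -
  let ?F = "\<lambda>A B. {f \<in> A \<rightarrow>\<^sub>E B. inj_on f A}"
  let ?h = "\<lambda>\<sigma>. (restrict \<sigma> R, restrict \<sigma> (S - R))"
  have fin: "finite R" "finite C" "finite (S - R)" "finite (S - C)"
    using assms finite_subset by auto
  have cc: "card (S - R) = card S - card R" "card (S - C) = card S - card R"
    using assms fin by (simp_all add: card_Diff_subset)
  have "card {\<sigma>. \<sigma> permutes S \<and> \<sigma> ` R = C} \<le> card (?F R C \<times> ?F (S - R) (S - C))"
  proof (rule card_inj_on_le[of ?h])
    show "inj_on ?h {\<sigma>. \<sigma> permutes S \<and> \<sigma> ` R = C}"
    proof (rule inj_onI, clarify)
      fix \<sigma> \<tau> assume p: "\<sigma> permutes S" "\<tau> permutes S"
        and e: "restrict \<sigma> R = restrict \<tau> R" "restrict \<sigma> (S - R) = restrict \<tau> (S - R)"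
      show "\<sigma> = \<tau>"
      proof
        fix i show "\<sigma> i = \<tau> i"
          using fun_cong[OF e(1), of i] fun_cong[OF e(2), of i] permutes_not_in[OF p(1), of i]
            permutes_not_in[OF p(2), of i] by (auto simp: restrict_def split: if_splits)
      qed
    qed
    show "?h ` {\<sigma>. \<sigma> permutes S \<and> \<sigma> ` R = C} \<subseteq> ?F R C \<times> ?F (S - R) (S - C)"
    proof (intro image_subsetI)
      fix \<sigma> assume "\<sigma> \<in> {\<sigma>. \<sigma> permutes S \<and> \<sigma> ` R = C}"
      then have p: "\<sigma> permutes S" and R: "\<sigma> ` R = C" by auto
      have "\<sigma> ` (S - R) = S - C"
        using permutes_image[OF p] R image_set_diff[OF permutes_inj[OF p]] by simp
      then show "?h \<sigma> \<in> ?F R C \<times> ?F (S - R) (S - C)"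
        using R permutes_inj_on[OF p] by auto
    qed
    show "finite (?F R C \<times> ?F (S - R) (S - C))"
      using fin finite_PiE[of R "\<lambda>_. C"] finite_PiE[of "S - R" "\<lambda>_. S - C"]
      by (intro finite_cartesian_product) simp_all
  qed
  also have "\<dots> = fact (card R) * fact (card S - card R)"
    using fin cc assms(4) by (simp add: card_cartesian_product card_inj_on_PiE)
  finally show ?thesis .
qed

text \<open>Each of the \<open>k!\<close> permutations gets a key: its cut step and the node reached
  there. The cut reads one of \<open>k * k\<close> matrix variables, so at most
  \<open>k * k * w\<close> keys occur, and each is shared by at most \<open>m! (k - m)!\<close>
  permutations.\<close>

lemma zero_line_OBDD_bound:
  assumes "zero_line n k \<in> OBDD n w" "k * k \<le> n" "1 \<le> m" "m \<le> k"
  shows "fact k \<le> k * k * w * (fact m * fact (k - m) :: nat)"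
proof -
  obtain P :: "nat bdd" where P: "obdd n P" "width n P \<le> w" "computes n P (zero_line n k)"
    using assms(1) unfolding OBDD_def by blast
  have N: "nobdd n P" using P(1) by (simp add: obdd_def)
  let ?\<pi> = "var_order P"
  have perm: "?\<pi> permutes {1..n}" using N by (simp add: nobdd_def)
  \<comment> \<open>\<open>x \<sigma>\<close> is the permutation matrix of \<open>\<sigma>\<close>,
    padded with zeros outside the matrix; \<open>pos \<sigma> a\<close> is the step at which its one
    in row \<open>a\<close> is read.\<close>
  define x where "x \<sigma> = restrict (\<lambda>i. \<exists>a<k. i = cell k a (\<sigma> a)) {1..n}" for \<sigma> :: "nat \<Rightarrow> nat"
  define pos where "pos \<sigma> a = inv ?\<pi> (cell k a (\<sigma> a))" for \<sigma> :: "nat \<Rightarrow> nat" and a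
  define Perm where "Perm = {\<sigma>. \<sigma> permutes {..<k}}"
  have x_cube: "x \<sigma> \<in> cube n" for \<sigma> by (simp add: x_def cube_def)
  have lt: "\<sigma> a < k" if "\<sigma> \<in> Perm" "a < k" for \<sigma> a
    using that permutes_in_image[of \<sigma> "{..<k}" a] by (simp add: Perm_def)
  have x_cell: "x \<sigma> (cell k a b) \<longleftrightarrow> b = \<sigma> a" if "a < k" "b < k" "\<sigma> \<in> Perm" for \<sigma> a b
  proof -
    have "cell k a b \<in> {1..n}" using cell_bounds[OF that(1,2)] assms(2) by auto
    then have "x \<sigma> (cell k a b) \<longleftrightarrow> (\<exists>c<k. cell k a b = cell k c (\<sigma> c))" by (simp add: x_def)
    also have "\<dots> \<longleftrightarrow> (\<exists>c<k. a = c \<and> b = \<sigma> c)"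
      by (intro ex_cong1 conj_cong refl cell_eq_iff that(2) lt[OF that(3)])
    also have "\<dots> \<longleftrightarrow> b = \<sigma> a" using that(1) by simp
    finally show ?thesis .
  qed
  have pos_mem: "pos \<sigma> a \<in> inv ?\<pi> ` {1..k * k}" if "\<sigma> \<in> Perm" "a < k" for \<sigma> a
    using cell_bounds[of a k "\<sigma> a"] lt[OF that] that(2) by (auto simp: pos_def)
  have pos_le: "inv ?\<pi> ` {1..k * k} \<subseteq> {1..n}"
    using permutes_image[OF permutes_inv[OF perm]] assms(2)
    by (metis atLeastatMost_subset_iff image_mono order_refl)
  \<comment> \<open>The cut \<open>t \<sigma>\<close> is the step reading the \<open>m\<close>-th
    one, found by ranking the rows by \<open>pos \<sigma>\<close>.\<close>
  have "\<exists>t\<in>inv ?\<pi> ` {1..k * k}. card {a \<in> {..<k}. pos \<sigma> a \<le> t} = m" if \<sigma>: "\<sigma> \<in> Perm" for \<sigma>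
  proof -
    have "inj_on (pos \<sigma>) {..<k}"
    proof (rule inj_onI)
      fix a b assume ab: "a \<in> {..<k}" "b \<in> {..<k}" "pos \<sigma> a = pos \<sigma> b"
      then have "cell k a (\<sigma> a) = cell k b (\<sigma> b)"
        using permutes_inj[OF permutes_inv[OF perm]] unfolding pos_def by (metis injD)
      then show "a = b" using ab lt[OF \<sigma>] by (simp add: cell_eq_iff)
    qed
    then have "\<exists>a\<in>{..<k}. card {b \<in> {..<k}. pos \<sigma> b \<le> pos \<sigma> a} = m"
      using assms(3,4) by (intro ex_rank) auto
    then show ?thesis using pos_mem[OF \<sigma>] by blast
  qed
  then obtain t where t: "\<And>\<sigma>. \<sigma> \<in> Perm \<Longrightarrow> t \<sigma> \<in> inv ?\<pi> ` {1..k * k}"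
    "\<And>\<sigma>. \<sigma> \<in> Perm \<Longrightarrow> card {a \<in> {..<k}. pos \<sigma> a \<le> t \<sigma>} = m"
    by metis
  have "\<forall>\<sigma>. \<exists>p. consistent_path n P (x \<sigma>) p" using obdd_unique_path[OF P(1)] by blast
  then obtain p where p: "\<And>\<sigma>. consistent_path n P (x \<sigma>) (p \<sigma>)" by metis
  define R where "R \<sigma> = {a \<in> {..<k}. pos \<sigma> a \<le> t \<sigma>}" for \<sigma>
  have rejects: "\<not> accepts n P (x \<sigma>)" if "\<sigma> \<in> Perm" for \<sigma>
  proof -
    have "\<not> zero_line n k (x \<sigma>)"
      unfolding not_zero_line_iff[OF x_cube]
    proof (intro conjI allI impI)
      show "\<exists>b<k. x \<sigma> (cell k a b)" if "a < k" for a
        using that lt[OF \<open>\<sigma> \<in> Perm\<close>] x_cell[OF _ _ \<open>\<sigma> \<in> Perm\<close>] by blast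
      show "\<exists>a<k. x \<sigma> (cell k a b)" if "b < k" for b
      proof -
        have "b \<in> \<sigma> ` {..<k}" using \<open>\<sigma> \<in> Perm\<close> that permutes_image unfolding Perm_def by blast
        then show ?thesis using that x_cell[OF _ _ \<open>\<sigma> \<in> Perm\<close>] by blast
      qed
    qed
    then show ?thesis using P(3) x_cube by (simp add: computes_def)
  qed
  have same: "R \<sigma> = R \<tau> \<and> \<sigma> ` R \<sigma> = \<tau> ` R \<tau>"
    if \<sigma>: "\<sigma> \<in> Perm" and \<tau>: "\<tau> \<in> Perm" and eq: "t \<sigma> = t \<tau>" "p \<sigma> (t \<sigma>) = p \<tau> (t \<tau>)" for \<sigma> \<tau>
  proof -
    let ?y = "splice P (t \<sigma>) (x \<sigma>) (x \<tau>)"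
    have y_cube: "?y \<in> cube n" using splice_in_cube x_cube by blast
    \<comment> \<open>Here determinism enters: the spliced path is the only path on
      \<open>?y\<close>, and it ends where the rejecting path of \<open>\<tau>\<close> ends.\<close>
    have "\<not> accepts n P ?y"
    proof
      assume "accepts n P ?y"
      then obtain r where r: "consistent_path n P ?y r" "r n \<in> accepting P"
        unfolding accepts_def by blast
      let ?r = "\<lambda>j. if j \<le> t \<sigma> then p \<sigma> j else p \<tau> j"
      have "consistent_path n P ?y ?r"
        using eq by (intro consistent_path_splice[OF N] p) simp
      then have "?r n = r n" by (rule obdd_path_eq[OF P(1) _ r(1) order_refl])
      moreover have "t \<sigma> \<le> n" using t(1)[OF \<sigma>] pos_le by auto
      then have "?r n = p \<tau> n" using eq by (cases "t \<sigma> = n") simp_all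
      ultimately have "accepts n P (x \<tau>)" using r(2) p[of \<tau>] unfolding accepts_def by auto
      then show False using rejects[OF \<tau>] by simp
    qed
    then have "\<not> zero_line n k ?y" using P(3) y_cube by (simp add: computes_def)
    then have rows: "\<And>a. a < k \<Longrightarrow> \<exists>b<k. ?y (cell k a b)"
      and cols: "\<And>b. b < k \<Longrightarrow> \<exists>a<k. ?y (cell k a b)"
      unfolding not_zero_line_iff[OF y_cube] by auto
    \<comment> \<open>A one of the spliced matrix comes from \<open>\<sigma>\<close> if read by the
      cut, and from \<open>\<tau>\<close> if read later.\<close>
    have y_cell: "a \<in> R \<sigma> \<and> b = \<sigma> a \<or> a \<notin> R \<tau> \<and> b = \<tau> a"
      if ab: "a < k" "b < k" "?y (cell k a b)" for a b
    proof -
      let ?j = "inv ?\<pi> (cell k a b)"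
      have j: "?\<pi> ?j = cell k a b" using permutes_inverses[OF perm] by simp
      have "?j \<in> {1..n}" using cell_bounds[OF ab(1,2)] pos_le by blast
      then have "?y (cell k a b) \<longleftrightarrow>
          (if ?j \<le> t \<sigma> then x \<sigma> (cell k a b) else x \<tau> (cell k a b))"
        using splice_var_order[OF N, of "t \<sigma>" "x \<sigma>" "x \<tau>" ?j] unfolding j by simp
      then show ?thesis
        using ab eq(1) x_cell[OF ab(1,2) \<sigma>] x_cell[OF ab(1,2) \<tau>]
        by (auto simp: R_def pos_def split: if_splits)
    qed
    have fin: "finite (R \<rho>)" for \<rho> by (simp add: R_def)
    have card_R: "card (R \<sigma>) = m" "card (R \<tau>) = m" using t(2) \<sigma> \<tau> by (simp_all add: R_def)
    have inj: "inj \<sigma>" "inj \<tau>" using \<sigma> \<tau> permutes_inj by (auto simp: Perm_def)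
    \<comment> \<open>A row of \<open>R \<tau>\<close> has lost its one from \<open>\<tau>\<close>,
      so its one must come from \<open>\<sigma>\<close>. Both sets have \<open>m\<close> elements,
      so inclusion gives equality.\<close>
    have "R \<tau> \<subseteq> R \<sigma>"
    proof
      fix a assume a: "a \<in> R \<tau>"
      then have "a < k" by (simp add: R_def)
      then show "a \<in> R \<sigma>" using rows y_cell a by blast
    qed
    then have "R \<tau> = R \<sigma>" using card_R fin by (intro card_subset_eq) auto
    \<comment> \<open>The same for columns: by injectivity \<open>\<tau>\<close> could fill column
      \<open>\<tau> c\<close> only from row \<open>c\<close>, which is lost.\<close>
    have "\<tau> ` R \<tau> \<subseteq> \<sigma> ` R \<sigma>"
    proof (intro image_subsetI)
      fix c assume c: "c \<in> R \<tau>"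
      then have "c < k" by (simp add: R_def)
      then obtain a where "a < k" "?y (cell k a (\<tau> c))" using cols lt[OF \<tau>] by blast
      then have "a \<in> R \<sigma> \<and> \<tau> c = \<sigma> a \<or> a \<notin> R \<tau> \<and> \<tau> c = \<tau> a"
        using y_cell lt[OF \<tau> \<open>c < k\<close>] by blast
      then show "\<tau> c \<in> \<sigma> ` R \<sigma>" using c injD[OF inj(2)] by blast
    qed
    moreover have "card (\<tau> ` R \<tau>) = card (\<sigma> ` R \<sigma>)"
      using card_R inj by (simp add: card_image inj_on_subset)
    ultimately have "\<tau> ` R \<tau> = \<sigma> ` R \<sigma>" using fin by (intro card_subset_eq) auto
    then show ?thesis using \<open>R \<tau> = R \<sigma>\<close> by simp
  qed
  define key where "key \<sigma> = (t \<sigma>, p \<sigma> (t \<sigma>))" for \<sigma>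
  \<comment> \<open>Only levels at which a matrix variable has just been read occur, so the number
    of keys does not depend on \<open>n\<close>.\<close>
  define K where "K = Sigma (inv ?\<pi> ` {1..k * k}) (level P)"
  have fin_level: "finite (level P j)" "card (level P j) \<le> w" if "j \<in> {1..n}" for j
    using that N P(2) by (auto simp: nobdd_def width_le_iff)
  have finK: "finite K" unfolding K_def using fin_level pos_le by (intro finite_SigmaI) auto
  have "card K = (\<Sum>j\<in>inv ?\<pi> ` {1..k * k}. card (level P j))"
    unfolding K_def using fin_level pos_le by (intro card_SigmaI) auto
  also have "\<dots> \<le> card (inv ?\<pi> ` {1..k * k}) * w"
    using sum_bounded_above[of "inv ?\<pi> ` {1..k * k}" "\<lambda>j. card (level P j)" w,
        OF fin_level(2)[OF subsetD[OF pos_le]]]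
    by simp
  also have "\<dots> \<le> k * k * w"
    using card_image_le[of "{1..k * k}" "inv ?\<pi>"] by (intro mult_le_mono1) simp
  finally have cardK: "card K \<le> k * k * w" .
  have key: "key \<sigma> \<in> K" if "\<sigma> \<in> Perm" for \<sigma>
  proof -
    have "t \<sigma> \<le> n" using t(1)[OF that] pos_le by auto
    then show ?thesis
      using t(1)[OF that] consistent_path_level[OF N p] by (simp add: key_def K_def)
  qed
  have fiber: "card {\<sigma> \<in> Perm. key \<sigma> = c} \<le> fact m * fact (k - m)" for c
  proof (cases "{\<sigma> \<in> Perm. key \<sigma> = c} = {}")
    case False
    then obtain \<tau> where \<tau>: "\<tau> \<in> Perm" "key \<tau> = c" by blast
    \<comment> \<open>By \<open>same\<close>, all permutations with this key send one fixed set of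
      rows onto one fixed set of columns.\<close>
    have "{\<sigma> \<in> Perm. key \<sigma> = c} \<subseteq> {\<sigma>. \<sigma> permutes {..<k} \<and> \<sigma> ` R \<tau> = \<tau> ` R \<tau>}"
    proof
      fix \<sigma> assume "\<sigma> \<in> {\<sigma> \<in> Perm. key \<sigma> = c}"
      then have \<sigma>: "\<sigma> \<in> Perm" "key \<sigma> = key \<tau>" using \<tau>(2) by auto
      then have "R \<sigma> = R \<tau> \<and> \<sigma> ` R \<sigma> = \<tau> ` R \<tau>"
        using \<tau>(1) by (intro same) (auto simp: key_def)
      then show "\<sigma> \<in> {\<sigma>. \<sigma> permutes {..<k} \<and> \<sigma> ` R \<tau> = \<tau> ` R \<tau>}"
        using \<sigma>(1) unfolding Perm_def by auto
    qed
    then have "card {\<sigma> \<in> Perm. key \<sigma> = c} \<le> card {\<sigma>. \<sigma> permutes {..<k} \<and> \<sigma> ` R \<tau> = \<tau> ` R \<tau>}"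
      by (rule card_mono[rotated]) (rule finite_subset[OF _ finite_permutations], auto)
    also have "\<dots> \<le> fact (card (R \<tau>)) * fact (card {..<k} - card (R \<tau>))"
    proof (rule card_permutes_image_le)
      show "R \<tau> \<subseteq> {..<k}" by (auto simp: R_def)
      then show "\<tau> ` R \<tau> \<subseteq> {..<k}" using lt[OF \<tau>(1)] by auto
      have "inj_on \<tau> (R \<tau>)" using \<tau>(1) permutes_inj_on by (auto simp: Perm_def)
      then show "card (\<tau> ` R \<tau>) = card (R \<tau>)" by (rule card_image)
    qed simp
    also have "\<dots> = fact m * fact (k - m)" using t(2)[OF \<tau>(1)] by (simp add: R_def)
    finally show ?thesis .
  next
    case True
    show ?thesis unfolding True by simp
  qed
  have "fact k = card Perm" unfolding Perm_def by (subst card_permutations[of _ k]) auto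
  also have "Perm = (\<Union>c\<in>K. {\<sigma> \<in> Perm. key \<sigma> = c})" using key by auto
  also have "card \<dots> \<le> (\<Sum>c\<in>K. card {\<sigma> \<in> Perm. key \<sigma> = c})" using finK by (rule card_UN_le)
  also have "\<dots> \<le> card K * (fact m * fact (k - m))"
    using sum_bounded_above[of K "\<lambda>c. card {\<sigma> \<in> Perm. key \<sigma> = c}", OF fiber] by simp
  also have "\<dots> \<le> k * k * w * (fact m * fact (k - m))"
    using cardK by (rule mult_le_mono1)
  finally show ?thesis .
qed

section \<open>Choice of parameters\<close>

text \<open>Equivalently, the central binomial coefficient of \<open>2 * m\<close> is at least
  \<open>2 ^ m\<close>. In the induction, \<open>(2 * m + 2) * (2 * m + 1)\<close> dominates
  \<open>2 * (m + 1) * (m + 1)\<close>.\<close>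

lemma fact_double_ge: "2 ^ m * (fact m * fact m) \<le> (fact (2 * m) :: nat)"
proof (induction m)
  case (Suc m)
  have "2 ^ Suc m * (fact (Suc m) * fact (Suc m)) =
      2 * (Suc m * Suc m) * (2 ^ m * (fact m * fact m :: nat))"
    by (simp add: algebra_simps)
  also have "\<dots> \<le> ((2 * m + 2) * (2 * m + 1)) * fact (2 * m)"
    by (rule mult_le_mono[OF _ Suc.IH]) (simp add: algebra_simps)
  also have "\<dots> = fact (2 * Suc m)" by (simp add: algebra_simps)
  finally show ?case .
qed simp

text \<open>The start is 1936 <= 2048, while at 10 the inequality fails (1600 > 1024). This is the
  source of the threshold 1024 in \<open>gap\<close>.\<close>

lemma square_le_exp: "11 \<le> L \<Longrightarrow> 16 * L * L \<le> (2::nat) ^ L"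
proof (induction L rule: dec_induct)
  case (step L)
  have "16 * Suc L * Suc L \<le> 2 * (16 * L * L)"
    using step(1) by (auto simp: algebra_simps dest!: le_Suc_ex)
  then show ?case using step by simp
qed simp

text \<open>Take \<open>k = 4 * L\<close> and \<open>m = 2 * L\<close>. Then
  \<open>binomial k m\<close> is at least \<open>2 ^ (2 * L)\<close>, whereas
  \<open>k * k * d < 2 ^ L * 2 ^ L\<close>. Also \<open>k * k \<le> 2 ^ L \<le> n\<close>, so the
  matrix fits.\<close>

lemma NOBDD_not_subset_OBDD:
  assumes "11 \<le> L" "d < 2 ^ L" "2 ^ L \<le> n" "8 * L \<le> d'"
  shows "\<not> NOBDD n d' \<subseteq> OBDD n d"
proof
  assume sub: "NOBDD n d' \<subseteq> OBDD n d"
  have kk: "4 * L * (4 * L) \<le> 2 ^ L" using square_le_exp[OF assms(1)] by simp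
  then have "zero_line n (4 * L) \<in> NOBDD n (2 * (4 * L))"
    using assms(1,3) by (intro zero_line_in_NOBDD) auto
  then have "zero_line n (4 * L) \<in> OBDD n d"
    using NOBDD_mono[of "2 * (4 * L)" d' n] assms(4) sub by auto
  then have "fact (4 * L) \<le> 4 * L * (4 * L) * d * (fact (2 * L) * fact (4 * L - 2 * L) :: nat)"
    using assms(1,3) kk by (intro zero_line_OBDD_bound[of n]) auto
  moreover have "2 ^ (2 * L) * (fact (2 * L) * fact (2 * L)) \<le> (fact (4 * L) :: nat)"
    using fact_double_ge[of "2 * L"] by simp
  ultimately have "2 ^ (2 * L) \<le> 4 * L * (4 * L) * d"
    using order_trans by (fastforce simp: mult_le_cancel2)
  also have "\<dots> \<le> 2 ^ L * d" using kk by (rule mult_le_mono1)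
  also have "\<dots> < 2 ^ L * 2 ^ L" using assms(2) by simp
  finally show False by (simp add: mult_2 power_add)
qed

lemma OBDD_not_subset_NOBDD:
  assumes "w < d" "2 * d \<le> n" shows "\<not> OBDD n d \<subseteq> NOBDD n w"
  using ones_dvd_in_OBDD[of d n] ones_dvd_not_in_NOBDD[OF assms] assms(1) by auto

text \<open>
  For \<open>d < 1024\<close> no \<open>d'\<close> satisfies \<open>gap d < d' < d\<close>; otherwise \<open>gap d = 2k\<close> with
  \<open>k = 4 (\<lfloor>log d\<rfloor> + 1)\<close>.
\<close>

definition gap :: "nat \<Rightarrow> real" where
  "gap d = (if d < 1024 then real d else 8 * (real_of_int \<lfloor>log 2 (real d)\<rfloor> + 1))"

text \<open>With \<open>?l = log 2 d\<close>, already \<open>8 * (?l + 1) \<le> 16 * ?l\<close>; the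
  further factors \<open>?l\<close> and \<open>log 2 ?l\<close> are at least 1 once
  \<open>?l \<ge> 2\<close>.\<close>

lemma gap_bigo: "gap \<in> O(\<lambda>d. (log 2 (real d))\<^sup>2 * log 2 (log 2 (real d)))"
proof (rule bigoI[of _ 16])
  show "\<forall>\<^sub>F d in at_top. norm (gap d) \<le> 16 * norm ((log 2 (real d))\<^sup>2 * log 2 (log 2 (real d)))"
    using eventually_ge_at_top[of "1024::nat"]
  proof eventually_elim
    case (elim d)
    let ?l = "log 2 (real d)"
    have l: "?l \<ge> 2" using elim by (simp add: le_log_iff)
    then have ll: "1 \<le> log 2 ?l" by (simp add: le_log_iff)
    have "gap d \<le> 8 * (?l + 1)" using elim by (simp add: gap_def)
    also have "\<dots> \<le> 16 * (?l * 1 * 1)" using l by simp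
    also have "\<dots> \<le> 16 * (?l * ?l * log 2 ?l)"
      using l ll by (intro mult_left_mono mult_mono) auto
    finally have "gap d \<le> 16 * (?l\<^sup>2 * log 2 ?l)" by (simp add: power2_eq_square)
    moreover have "0 \<le> gap d" using elim l by (simp add: gap_def)
    moreover have "0 \<le> ?l\<^sup>2 * log 2 ?l" using l ll by simp
    ultimately show ?case by simp
  qed
qed

theorem theorem8:
  "\<exists>g :: nat \<Rightarrow> real.
     g \<in> O(\<lambda>d. (log 2 (real d))\<^sup>2 * log 2 (log 2 (real d))) \<and>
     (\<forall>n d d' :: nat.
        real d \<le> real n / 2 \<and> g d < real d' \<and> real d' \<le> real d - 1 \<longrightarrow>
          NOBDD n (nat \<lfloor>log 2 (real d)\<rfloor>) \<subset> OBDD n d \<and>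
          (\<not> OBDD n d \<subseteq> NOBDD n d' \<and> \<not> NOBDD n d' \<subseteq> OBDD n d))"
proof (intro exI[of _ gap] conjI[OF gap_bigo] allI impI)
  fix n d d' :: nat
  assume "real d \<le> real n / 2 \<and> gap d < real d' \<and> real d' \<le> real d - 1"
  then have n: "2 * d \<le> n" and gap: "gap d < real d'" and d': "d' < d" by linarith+
  have d: "1024 \<le> d" using gap d' by (auto simp: gap_def split: if_splits)
  define l where "l = nat \<lfloor>log 2 (real d)\<rfloor>"
  have fl: "\<lfloor>log 2 (real d)\<rfloor> = int l" using d by (simp add: l_def)
  then have "2 ^ l \<le> d" "d < 2 ^ Suc l"
    using d by (auto simp: floor_log_nat_eq_powr_iff[of 2 d l, simplified])
  \<comment> \<open>From \<open>2 ^ 10 \<le> d < 2 ^ Suc l\<close>; hence \<open>Suc l\<close> is at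
    least the 11 required below.\<close>
  have "10 \<le> l"
  proof (rule ccontr)
    assume "\<not> 10 \<le> l"
    then have "(2::nat) ^ Suc l \<le> 2 ^ 10" by (intro power_increasing) auto
    then show False using d \<open>d < 2 ^ Suc l\<close> by simp
  qed
  have l_le: "8 * Suc l \<le> d'" using gap d by (simp add: gap_def fl)
  \<comment> \<open>With \<open>L = Suc l\<close>,
    \<open>d < 2 ^ L \<le> 2 * d \<le> n\<close>.\<close>
  have "\<not> NOBDD n d' \<subseteq> OBDD n d"
    using \<open>10 \<le> l\<close> \<open>d < 2 ^ Suc l\<close> \<open>2 ^ l \<le> d\<close> n l_le
    by (intro NOBDD_not_subset_OBDD[of "Suc l"]) auto
  \<comment> \<open>Both widths are below \<open>d\<close>: \<open>8 * Suc l \<le> d' < d\<close>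
    also gives \<open>l < d\<close>.\<close>
  moreover have "\<not> OBDD n d \<subseteq> NOBDD n d'" "\<not> OBDD n d \<subseteq> NOBDD n l"
    using d' n l_le by (intro OBDD_not_subset_NOBDD; simp)+
  moreover have "NOBDD n l \<subseteq> OBDD n d"
    using NOBDD_subset_OBDD_exp OBDD_mono[OF \<open>2 ^ l \<le> d\<close>] by blast
  ultimately show "NOBDD n (nat \<lfloor>log 2 (real d)\<rfloor>) \<subset> OBDD n d \<and>
      (\<not> OBDD n d \<subseteq> NOBDD n d' \<and> \<not> NOBDD n d' \<subseteq> OBDD n d)"
    unfolding l_def by blast
qed

end
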